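(* Fix integers $\ell\ge1$ and $C\ge0$ (independent of $n$). For each $n\ge1$ let $D_1,\dots,D_\ell$ be pairwise edge-disjoint subgraphs of $K_{2n}$ with $\Delta(D_m)\le C$ for each $m$. Let $R$ be a uniformly random perfect matching of $K_{2n}$. Let $\mathbf X=(X_m)_{m=1}^\ell$ with $X_m=|E(R\cap D_m)|$ and $\mathbf Y=(Y_m)_{m=1}^\ell$ with the $Y_m$ independent and $Y_m\sim\mathrm{Poisson}(|E(D_m)|/(2n))$. Then $\lim_{n\to\infty}d_{TV}(\mathbf X,\mathbf Y)=0$.
   Context: For random vectors on $\mathbb N^\ell$, $d_{TV}(\mathbf X,\mathbf Y)=\sum_{\mathbf k\in\mathbb N^\ell}|\mathbb P(\mathbf X=\mathbf k)-\mathbb P(\mathbf Y=\mathbf k)|$. $\Delta$ is maximum degree. *)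

theory Defs
  imports "HOL-Probability.Probability"
begin

text \<open>A finite simple graph is a pair of a vertex set and a set of edges, each edge being a
  two-element set of vertices.\<close>

type_synonym 'a graph = "'a set \<times> 'a set set"

abbreviation verts :: "'a graph \<Rightarrow> 'a set" where "verts \<equiv> fst"
abbreviation edges :: "'a graph \<Rightarrow> 'a set set" where "edges \<equiv> snd"

definition simple_graph :: "'a graph \<Rightarrow> bool" where
  "simple_graph G \<longleftrightarrow> finite (verts G) \<and> (\<forall>e\<in>edges G. e \<subseteq> verts G \<and> card e = 2)"

definition subgraph :: "'a graph \<Rightarrow> 'a graph \<Rightarrow> bool" where
  "subgraph H G \<longleftrightarrow> simple_graph H \<and> verts H \<subseteq> verts G \<and> edges H \<subseteq> edges G"

definition graph_inter :: "'a graph \<Rightarrow> 'a graph \<Rightarrow> 'a graph" where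
  "graph_inter G H = (verts G \<inter> verts H, edges G \<inter> edges H)"

definition complete_nat_graph :: "nat \<Rightarrow> nat graph" where
  "complete_nat_graph N = ({..<N}, {e. e \<subseteq> {..<N} \<and> card e = 2})"

definition vertex_degree :: "'a graph \<Rightarrow> 'a \<Rightarrow> nat" where
  "vertex_degree G v = card {e \<in> edges G. v \<in> e}"

text \<open>The supremum of the empty set of naturals is \<open>0\<close>, so a graph without vertices has maximum
  degree \<open>0\<close>.\<close>

definition max_degree :: "'a graph \<Rightarrow> nat" where
  "max_degree G = (SUP v\<in>verts G. vertex_degree G v)"

text \<open>A perfect matching is regarded as a spanning subgraph.\<close>

definition perfect_matching :: "'a graph \<Rightarrow> 'a graph \<Rightarrow> bool" where
  "perfect_matching M G \<longleftrightarrow>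
     subgraph M G \<and> verts M = verts G \<and> (\<forall>v\<in>verts G. \<exists>!e. e \<in> edges M \<and> v \<in> e)"

definition uniform_perfect_matching :: "'a graph \<Rightarrow> 'a graph pmf" where
  "uniform_perfect_matching G = pmf_of_set {M. perfect_matching M G}"

lemma perfect_matchings_complete_nat_graph:
  shows "finite {M. perfect_matching M (complete_nat_graph (2 * n))}"
    and "{M. perfect_matching M (complete_nat_graph (2 * n))} \<noteq> {}"
proof -
  have "{M. perfect_matching M (complete_nat_graph (2 * n))}
          \<subseteq> Pow {..<2 * n} \<times> Pow (Pow {..<2 * n})"
    by (auto simp: perfect_matching_def subgraph_def complete_nat_graph_def)
  then show "finite {M. perfect_matching M (complete_nat_graph (2 * n))}"
    by (rule finite_subset) auto
  define E :: "nat set set" where "E = (\<lambda>i. {2 * i, 2 * i + 1}) ` {..<n}"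
  have "\<exists>!e. e \<in> E \<and> v \<in> e" if "v < 2 * n" for v
  proof (rule ex1I[of _ "{2 * (v div 2), 2 * (v div 2) + 1}"])
    show "{2 * (v div 2), 2 * (v div 2) + 1} \<in> E \<and> v \<in> {2 * (v div 2), 2 * (v div 2) + 1}"
      using that by (auto simp: E_def)
  next
    fix e assume "e \<in> E \<and> v \<in> e"
    then obtain i where "e = {2 * i, 2 * i + 1}" "v \<in> e" by (auto simp: E_def)
    moreover from this have "i = v div 2" by auto
    ultimately show "e = {2 * (v div 2), 2 * (v div 2) + 1}" by simp
  qed
  moreover have "finite e \<and> (\<forall>v\<in>e. v < 2 * n) \<and> card e = 2" if "e \<in> E" for e
    using that by (auto simp: E_def)
  ultimately have "perfect_matching ({..<2 * n}, E) (complete_nat_graph (2 * n))"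
    by (auto simp: perfect_matching_def subgraph_def simple_graph_def complete_nat_graph_def)
  then show "{M. perfect_matching M (complete_nat_graph (2 * n))} \<noteq> {}" by blast
qed

text \<open>\<^const>\<open>poisson_pmf\<close> is only specified for positive rates; here rate \<open>0\<close>, arising from graphs
  without edges, is included as the point mass at \<open>0\<close>.\<close>

definition poisson :: "real \<Rightarrow> nat pmf" where
  "poisson r = (if r = 0 then return_pmf 0 else poisson_pmf r)"

lemma pmf_poisson_nonneg: "0 \<le> r \<Longrightarrow> pmf (poisson r) k = r ^ k / fact k * exp (- r)"
  by (cases k) (auto simp: poisson_def)

text \<open>A vector in \<open>\<nat>\<^sup>l\<close> is a function on \<open>{1..l}\<close> extended by \<^term>\<open>undefined\<close>; the second
  argument of \<^const>\<open>Pi_pmf\<close> is chosen accordingly when independent components are combined.\<close>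

definition nat_vectors :: "nat \<Rightarrow> (nat \<Rightarrow> nat) set" where
  "nat_vectors l = {1..l} \<rightarrow>\<^sub>E UNIV"

text \<open>The distance is defined as the full sum, without the common factor \<open>1/2\<close>.\<close>

definition d_TV :: "nat \<Rightarrow> (nat \<Rightarrow> nat) pmf \<Rightarrow> (nat \<Rightarrow> nat) pmf \<Rightarrow> real" where
  "d_TV l P Q = (\<Sum>\<^sub>\<infinity>k\<in>nat_vectors l. \<bar>pmf P k - pmf Q k\<bar>)"

lemma d_TV_summable: "(\<lambda>k. \<bar>pmf P k - pmf Q k\<bar>) summable_on nat_vectors l"
proof -
  have "Infinite_Set_Sum.abs_summable_on (\<lambda>k. pmf P k - pmf Q k) (nat_vectors l)"
    by (intro abs_summable_on_diff pmf_abs_summable)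
  then show ?thesis
    by (simp only: abs_summable_equivalent[symmetric] real_norm_def)
qed

definition law_X :: "nat \<Rightarrow> nat \<Rightarrow> (nat \<Rightarrow> nat graph) \<Rightarrow> (nat \<Rightarrow> nat) pmf" where
  "law_X l n D =
     map_pmf (\<lambda>R. \<lambda>m\<in>{1..l}. card (edges (graph_inter R (D m))))
       (uniform_perfect_matching (complete_nat_graph (2 * n)))"

definition law_Y :: "nat \<Rightarrow> nat \<Rightarrow> (nat \<Rightarrow> nat graph) \<Rightarrow> (nat \<Rightarrow> nat) pmf" where
  "law_Y l n D =
     Pi_pmf {1..l} undefined (\<lambda>m. poisson (real (card (edges (D m))) / (2 * real n)))"

end

theory Submission
  imports Defs
begin

text \<open>By binomial inversion, \<open>pmf P k = \<Sum>j. (\<Prod>m. (-1)^(j m + k m) * (j m choose k m)) * S j\<close>,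
  where \<open>S j\<close> is the joint binomial moment \<open>E (\<Prod>m. X m choose j m)\<close>; for independent Poisson
  variables \<open>S j = \<Prod>m. r m ^ j m / (j m)!\<close>. Summing over \<open>k\<close> bounds the distance of two laws by
  \<open>\<Sum>j. 2^\<bar>j\<bar> * \<bar>S j - T j\<bar>\<close>. Removing the edges of a matching one at a time leaves complete graphs on
  fewer vertices, and in each of them the degree bound limits the conditional expected number of
  edges of \<open>D m\<close> in the matching by \<open>C\<close>. So both moments are at most \<open>\<Prod>m. C ^ j m / (j m)!\<close>
  uniformly in \<open>n\<close>, and dominated convergence reduces the claim to \<open>S j - T j \<longlonglongrightarrow> 0\<close> for each fixed
  \<open>j\<close>. No limits of the Poisson rates are needed.\<close>

subsection \<open>Binomial inversion\<close>

lemma binomial_div_fact: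
  "real ((i + k) choose k) * (r ^ (i + k) / fact (i + k)) = r ^ k / fact k * (r ^ i / fact i)"
proof -
  have "real ((i + k) choose k) = fact (i + k) / (fact k * fact i)"
    using binomial_fact[of k "i + k", where 'a = real] by simp
  then show ?thesis by (simp add: power_add)
qed

text \<open>With \<open>j = i + k\<close> the terms factor as \<open>r ^ k / fact k\<close> times
  the exponential series of \<open>- r\<close>, and the terms with \<open>j < k\<close> vanish.
  Absolute summability is recorded because the passage to vectors multiplies such series.\<close>

lemma binomial_inversion_poisson:
  fixes r :: real
  defines "f \<equiv> \<lambda>k j. (-1) ^ (j + k) * real (j choose k) * (r ^ j / fact j)"
  shows "(f k has_sum (r ^ k / fact k * exp (- r))) UNIV"
    and "(\<lambda>j. norm (f k j)) summable_on UNIV"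
proof -
  have shift: "f k (i + k) = r ^ k / fact k * ((- r) ^ i / fact i)" for i
  proof -
    have "f k (i + k) = (-1) ^ (i + k + k) * (real ((i + k) choose k) * (r ^ (i + k) / fact (i + k)))"
      by (simp add: f_def)
    also have "\<dots> = (-1) ^ i * (r ^ k / fact k * (r ^ i / fact i))"
      unfolding binomial_div_fact by (simp add: power_add flip: power_mult_distrib)
    finally show ?thesis by (simp add: power_minus[of r i])
  qed
  have low: "f k j = 0" if "j < k" for j using that by (simp add: f_def)
  have "(\<lambda>i. r ^ k / fact k * ((- r) ^ i / fact i)) sums (r ^ k / fact k * exp (- r))"
    by (intro sums_mult) (use exp_converges[of "-r"] in \<open>simp add: scaleR_conv_of_real divide_inverse mult.commute\<close>)
  then have sums: "f k sums (r ^ k / fact k * exp (- r))"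
    unfolding shift[symmetric] by (subst (asm) sums_iff_shift) (simp add: low)
  have "summable (\<lambda>i. norm (r ^ k / fact k) * (norm ((- r) ^ i / fact i)))"
    by (intro summable_mult) (use summable_norm_exp[of "- r"] in \<open>simp add: divide_inverse mult.commute\<close>)
  then have "summable (\<lambda>i. norm (f k (i + k)))"
    unfolding shift by (simp add: norm_mult abs_mult)
  then have "summable (\<lambda>i. norm (f k i))"
    by (subst (asm) summable_iff_shift)
  then show "(f k has_sum (r ^ k / fact k * exp (- r))) UNIV"
    and "(\<lambda>j. norm (f k j)) summable_on UNIV"
    using sums by (auto intro: norm_summable_imp_has_sum norm_summable_imp_summable_on)
qed

text \<open>Only \<open>j\<close> between \<open>k\<close> and \<open>x\<close> contributes. There
  \<open>(x choose j) * (j choose k)\<close> equals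
  \<open>(x choose k) * ((x - k) choose (j - k))\<close>, which leaves an alternating binomial row;
  it sums to zero unless \<open>x = k\<close>.\<close>

lemma binomial_inversion_indicator:
  fixes x k :: nat
  defines "f \<equiv> \<lambda>j. (-1) ^ (j + k) * real (j choose k) * real (x choose j)"
  shows "(f has_sum of_bool (x = k)) UNIV"
    and "(\<lambda>j. norm (f j)) summable_on UNIV"
proof -
  have z: "f j = 0" if "j \<notin> {k..x}" for j using that by (auto simp: f_def)
  have "(\<Sum>j\<in>{k..x}. f j) = of_bool (x = k)"
  proof (cases "k \<le> x")
    case True
    have "(\<Sum>j\<in>{k..x}. f j) = (\<Sum>i\<le>x - k. f (i + k))"
      using True sum.shift_bounds_cl_nat_ivl[of f 0 k "x - k"] by (simp add: atMost_atLeast0)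
    also have "\<dots> = (\<Sum>i\<le>x - k. real (x choose k) * ((-1) ^ i * real (x - k choose i)))"
    proof (rule sum.cong[OF refl])
      fix i assume "i \<in> {..x - k}"
      then have "(x choose (i + k)) * (i + k choose k) = (x choose k) * (x - k choose i)"
        using choose_mult[of k "i + k" x] True by simp
      then have e: "real (x choose (i + k)) * real (i + k choose k) = real (x choose k) * real (x - k choose i)"
        by (metis of_nat_mult)
      have "f (i + k) = (-1) ^ (i + k + k) * (real (x choose (i + k)) * real (i + k choose k))"
        by (simp add: f_def)
      also have "\<dots> = (-1) ^ i * (real (x choose k) * real (x - k choose i))"
        by (simp only: e) (simp add: power_add flip: power_mult_distrib)
      finally show "f (i + k) = real (x choose k) * ((-1) ^ i * real (x - k choose i))" by simp
    qed
    also have "\<dots> = of_bool (x = k)"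
      using choose_alternating_sum[of "x - k", where 'a = real] True
      by (cases "x = k") (auto simp flip: sum_distrib_left)
    finally show ?thesis .
  qed (auto)
  then show "(f has_sum of_bool (x = k)) UNIV"
    using z by (intro has_sum_finite_neutralI[of "{k..x}"]) auto
  have "(\<lambda>j. norm (f j)) summable_on {k..x}" by simp
  then show "(\<lambda>j. norm (f j)) summable_on UNIV"
    by (rule summable_on_cong_neutral[THEN iffD1, rotated -1]) (auto simp: z)
qed

section \<open>Sums over vectors and dominated convergence for sums\<close>

text \<open>Lifts the one-variable inversion formulas to vectors: expanding a finite product of
  absolutely summable series gives one series over all choices of indices.\<close>

lemma
  fixes f :: "'a \<Rightarrow> 'b::countable \<Rightarrow> real"
  assumes "finite A" "\<And>x. x \<in> A \<Longrightarrow> (f x has_sum s x) UNIV"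
    and "\<And>x. x \<in> A \<Longrightarrow> (\<lambda>y. norm (f x y)) summable_on UNIV"
  shows has_sum_prod_PiE: "((\<lambda>g. \<Prod>x\<in>A. f x (g x)) has_sum (\<Prod>x\<in>A. s x)) (A \<rightarrow>\<^sub>E UNIV)"
    and abs_summable_prod_PiE: "(\<lambda>g. norm (\<Prod>x\<in>A. f x (g x))) summable_on (A \<rightarrow>\<^sub>E UNIV)"
proof -
  show 1: "(\<lambda>g. norm (\<Prod>x\<in>A. f x (g x))) summable_on (A \<rightarrow>\<^sub>E UNIV)"
    using abs_summable_on_prod_PiE[of A "\<lambda>_. UNIV" f] assms
    by (simp add: abs_summable_equivalent[symmetric])
  have "infsum (\<lambda>g. \<Prod>x\<in>A. f x (g x)) (A \<rightarrow>\<^sub>E UNIV) = (\<Prod>x\<in>A. infsum (f x) UNIV)"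
    using assms by (intro infsum_prod_PiE_abs) auto
  also have "\<dots> = (\<Prod>x\<in>A. s x)" using assms(2) by (intro prod.cong) (auto intro: infsumI)
  finally show "((\<lambda>g. \<Prod>x\<in>A. f x (g x)) has_sum (\<Prod>x\<in>A. s x)) (A \<rightarrow>\<^sub>E UNIV)"
    using 1 abs_summable_summable has_sum_infsum by metis
qed

lemma has_sum_sum:
  fixes f :: "'i \<Rightarrow> 'a \<Rightarrow> 'b::topological_comm_monoid_add"
  assumes "\<And>i. i \<in> I \<Longrightarrow> (f i has_sum s i) A"
  shows "((\<lambda>x. \<Sum>i\<in>I. f i x) has_sum (\<Sum>i\<in>I. s i)) A"
  using assms
proof (induction I rule: infinite_finite_induct)
  case (insert i I)
  have "((\<lambda>x. f i x + (\<Sum>i\<in>I. f i x)) has_sum (s i + (\<Sum>i\<in>I. s i))) A"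
    using insert.prems by (intro has_sum_add insert.IH) blast+
  then show ?case
    by (simp only: sum.insert[OF insert.hyps])
qed simp_all

text \<open>Dominated convergence for the counting measure. The bound is asked only from
  \<open>n0\<close> on because the moment estimates below hold for \<open>n \<ge> 1\<close>.\<close>

lemma tendsto_infsum_dominated:
  fixes f :: "nat \<Rightarrow> 'a \<Rightarrow> real"
  assumes w: "w summable_on A"
    and nn: "\<And>x. x \<in> A \<Longrightarrow> 0 \<le> w x"
    and le: "\<And>n x. n \<ge> n0 \<Longrightarrow> x \<in> A \<Longrightarrow> norm (f n x) \<le> w x"
    and lim: "\<And>x. x \<in> A \<Longrightarrow> (\<lambda>n. f n x) \<longlonglongrightarrow> g x"
  shows "(\<lambda>n. infsum (f n) A) \<longlonglongrightarrow> infsum g A"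
proof -
  have fle: "norm (f (n + n0) x) \<le> w x" if "x \<in> A" for n x using le that by simp
  have lim': "(\<lambda>n. f (n + n0) x) \<longlonglongrightarrow> g x" if "x \<in> A" for x
    using lim[OF that] by (rule LIMSEQ_ignore_initial_segment)
  have gle: "norm (g x) \<le> w x" if "x \<in> A" for x
    using fle[OF that] tendsto_norm[OF lim'[OF that]] by (intro LIMSEQ_le_const2) auto
  have "(\<lambda>x. norm (w x)) summable_on A"
    by (rule summable_on_cong[THEN iffD1, OF _ w]) (simp add: nn)
  then have wS: "Infinite_Set_Sum.abs_summable_on w A"
    by (simp only: abs_summable_equivalent)
  then have wA: "integrable (count_space A) w"
    by (simp add: Infinite_Set_Sum.abs_summable_on_def)
  \<comment> \<open>On dominated functions the unordered sum is a Lebesgue integral. This is applied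
    to the terms of the sequence and to their limit, which inherits the bound.\<close>
  have eq: "infsum h A = integral\<^sup>L (count_space A) h" if "\<And>x. x \<in> A \<Longrightarrow> norm (h x) \<le> w x" for h :: "'a \<Rightarrow> real"
  proof -
    have "Infinite_Set_Sum.abs_summable_on h A"
      using wS that by (rule Infinite_Set_Sum.abs_summable_on_comparison_test')
    then show ?thesis
      by (simp add: infsetsum_infsum[symmetric] infsetsum_def)
  qed
  have "(\<lambda>n. integral\<^sup>L (count_space A) (f (n + n0))) \<longlonglongrightarrow> integral\<^sup>L (count_space A) g"
    by (rule integral_dominated_convergence[where w = w])
       (use wA fle lim' in \<open>simp_all add: AE_count_space\<close>)
  then have "(\<lambda>n. infsum (f (n + n0)) A) \<longlonglongrightarrow> infsum g A"
    by (simp only: eq[OF fle] eq[OF gle])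
  then show ?thesis by (rule LIMSEQ_offset)
qed

subsection \<open>Uniform perfect matchings\<close>

text \<open>Only the edge set is kept, since the vertex set is always \<open>V\<close>. Letting
  \<open>V\<close> be any set keeps the notion stable when the ends of an edge are deleted.\<close>

definition perfect_matchings :: "'a set \<Rightarrow> 'a set set set" where
  "perfect_matchings V =
     {R. (\<forall>e\<in>R. e \<subseteq> V \<and> card e = 2) \<and> (\<forall>v\<in>V. \<exists>!e. e \<in> R \<and> v \<in> e)}"

lemma finite_perfect_matchings: "finite V \<Longrightarrow> finite (perfect_matchings V)"
  by (rule finite_subset[of _ "Pow (Pow V)"]) (auto simp: perfect_matchings_def)

lemma perfect_matchings_empty: "perfect_matchings {} = {{}}"
  by (auto simp: perfect_matchings_def)

lemma finite_matching: "finite V \<Longrightarrow> R \<in> perfect_matchings V \<Longrightarrow> finite R"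
  by (rule finite_subset[of _ "Pow V"]) (auto simp: perfect_matchings_def)

text \<open>An edge \<open>e\<close> of a perfect matching is the only one meeting its ends, so the
  other edges match \<open>V - e\<close>; conversely \<open>e\<close> can be put back. Both the
  count and the moment recursion descend by this step.\<close>

lemma bij_betw_remove_edge:
  assumes "e \<subseteq> V" "card e = 2"
  shows "bij_betw (\<lambda>R. R - {e}) {R \<in> perfect_matchings V. e \<in> R} (perfect_matchings (V - e))"
proof (rule bij_betw_byWitness[where f' = "insert e"])
  have new: "e \<notin> R" if "R \<in> perfect_matchings (V - e)" for R
  proof
    assume "e \<in> R"
    then have "e = {}" using that by (auto simp: perfect_matchings_def)
    then show False using assms by simp
  qed
  show "\<forall>R\<in>{R \<in> perfect_matchings V. e \<in> R}. insert e (R - {e}) = R" by auto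
  show "\<forall>R\<in>perfect_matchings (V - e). insert e R - {e} = R" using new by auto
  show "(\<lambda>R. R - {e}) ` {R \<in> perfect_matchings V. e \<in> R} \<subseteq> perfect_matchings (V - e)"
  proof clarify
    fix R assume R: "R \<in> perfect_matchings V" "e \<in> R"
    have "f \<subseteq> V - e" if "f \<in> R - {e}" for f
    proof
      fix v assume v: "v \<in> f"
      have "f \<in> R" "f \<subseteq> V" using that R by (auto simp: perfect_matchings_def)
      moreover from this v R have "\<exists>!g. g \<in> R \<and> v \<in> g"
        unfolding perfect_matchings_def by blast
      ultimately show "v \<in> V - e" using v R(2) that by blast
    qed
    moreover have "\<exists>!f. f \<in> R - {e} \<and> v \<in> f" if "v \<in> V - e" for v
    proof -
      have "\<exists>!f. f \<in> R \<and> v \<in> f" using R that by (auto simp: perfect_matchings_def)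
      then show ?thesis using that by (metis DiffE DiffI singletonD)
    qed
    ultimately show "R - {e} \<in> perfect_matchings (V - e)"
      using R by (auto simp: perfect_matchings_def)
  qed
  show "insert e ` perfect_matchings (V - e) \<subseteq> {R \<in> perfect_matchings V. e \<in> R}"
  proof clarify
    fix R assume R: "R \<in> perfect_matchings (V - e)"
    have sub: "f \<subseteq> V - e" if "f \<in> R" for f using R that by (auto simp: perfect_matchings_def)
    have "\<exists>!f. f \<in> insert e R \<and> v \<in> f" if "v \<in> V" for v
    proof (cases "v \<in> e")
      case True
      then show ?thesis using sub by blast
    next
      case False
      then have "\<exists>!f. f \<in> R \<and> v \<in> f" using R that by (auto simp: perfect_matchings_def)
      then show ?thesis using False by (metis insert_iff)
    qed
    then show "insert e R \<in> perfect_matchings V \<and> e \<in> insert e R"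
      using R assms by (auto simp: perfect_matchings_def)
  qed
qed

lemma card_edge_perfect_matchings:
  "e \<subseteq> V \<Longrightarrow> card e = 2 \<Longrightarrow>
     card {R \<in> perfect_matchings V. e \<in> R} = card (perfect_matchings (V - e))"
  using bij_betw_remove_edge bij_betw_same_card by blast

text \<open>The value is the double factorial (2k-1)!!. A fixed vertex has \<open>card V - 1\<close>
  possible partners, the matchings split according to the partner, and each class is counted by the
  matchings of the remaining vertices.\<close>

lemma card_perfect_matchings:
  assumes "finite V" "card V = 2 * k"
  shows "card (perfect_matchings V) = (\<Prod>i<k. 2 * i + 1)"
  using assms
proof (induction k arbitrary: V)
  case 0
  then show ?case by (simp add: perfect_matchings_empty)
next
  case (Suc k)
  then have "V \<noteq> {}" by auto
  then obtain v where v: "v \<in> V" by blast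
  have split: "perfect_matchings V = (\<Union>u\<in>V - {v}. {R \<in> perfect_matchings V. {v, u} \<in> R})"
  proof (intro equalityI subsetI)
    fix R assume R: "R \<in> perfect_matchings V"
    then obtain e where e: "e \<in> R" "v \<in> e" "e \<subseteq> V" "card e = 2"
      using v by (auto simp: perfect_matchings_def)
    then obtain u where "e = {v, u}" "u \<noteq> v" by (auto simp: card_2_iff)
    then show "R \<in> (\<Union>u\<in>V - {v}. {R \<in> perfect_matchings V. {v, u} \<in> R})" using e R by auto
  qed auto
  have "card (perfect_matchings V) = (\<Sum>u\<in>V - {v}. card {R \<in> perfect_matchings V. {v, u} \<in> R})"
  proof (subst split, rule card_UN_disjoint)
    show "finite (V - {v})" "\<forall>i\<in>V - {v}. finite {R \<in> perfect_matchings V. {v, i} \<in> R}"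
      using Suc.prems by (auto simp: finite_perfect_matchings)
    show "\<forall>i\<in>V - {v}. \<forall>j\<in>V - {v}. i \<noteq> j \<longrightarrow>
      {R \<in> perfect_matchings V. {v, i} \<in> R} \<inter> {R \<in> perfect_matchings V. {v, j} \<in> R} = {}"
    proof (intro ballI impI equals0I)
      fix i j R assume ij: "i \<in> V - {v}" "j \<in> V - {v}" "i \<noteq> j"
        "R \<in> {R \<in> perfect_matchings V. {v, i} \<in> R} \<inter> {R \<in> perfect_matchings V. {v, j} \<in> R}"
      then have "\<exists>!e. e \<in> R \<and> v \<in> e" using v by (auto simp: perfect_matchings_def)
      then have "{v, i} = {v, j}" using ij by blast
      then show False using ij by (auto simp: doubleton_eq_iff)
    qed
  qed
  also have "\<dots> = (\<Sum>u\<in>V - {v}. (\<Prod>i<k. 2 * i + 1))"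
  proof (rule sum.cong[OF refl])
    fix u assume u: "u \<in> V - {v}"
    then have c: "card {v, u} = 2" "{v, u} \<subseteq> V" using v by auto
    then have "card (V - {v, u}) = 2 * k"
      using Suc.prems by (subst card_Diff_subset) auto
    then have "card (perfect_matchings (V - {v, u})) = (\<Prod>i<k. 2 * i + 1)"
      using Suc by (intro Suc.IH) auto
    then show "card {R \<in> perfect_matchings V. {v, u} \<in> R} = (\<Prod>i<k. 2 * i + 1)"
      using card_edge_perfect_matchings c by metis
  qed
  also have "\<dots> = (\<Prod>i<Suc k. 2 * i + 1)"
    using Suc.prems v by simp
  finally show ?case .
qed

lemma card_perfect_matchings_pos:
  "finite V \<Longrightarrow> even (card V) \<Longrightarrow> card (perfect_matchings V) > 0"
  by (auto simp: card_perfect_matchings elim!: evenE intro!: prod_pos)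

text \<open>\<open>num_coloured\<close> counts the sequences of distinct edges of \<open>R\<close> whose colours are prescribed by a
  word. \<open>factorial_moment\<close> is its expectation over a uniform perfect matching of \<open>V\<close>: a given edge \<open>e\<close>
  is matched with probability \<open>1 / (card V - 1)\<close>, and what remains is uniform on \<open>V - e\<close>.\<close>

fun num_coloured :: "('c \<Rightarrow> 'a set set) \<Rightarrow> 'a set set \<Rightarrow> 'c list \<Rightarrow> nat" where
  "num_coloured G R [] = 1"
| "num_coloured G R (m # w) = (\<Sum>e\<in>G m \<inter> R. num_coloured G (R - {e}) w)"

fun factorial_moment :: "('c \<Rightarrow> 'a set set) \<Rightarrow> 'a set \<Rightarrow> 'c list \<Rightarrow> real" where
  "factorial_moment G V [] = 1"
| "factorial_moment G V (m # w) =
     (\<Sum>e\<in>{e \<in> G m. e \<subseteq> V}. factorial_moment G (V - e) w) / (real (card V) - 1)"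

text \<open>Exchanging the sum over matchings with the sum over the first edge \<open>e\<close>
  leaves, for each \<open>e\<close>, a sum over the matchings of \<open>V - e\<close>, to which the
  shorter word applies.\<close>

lemma sum_num_coloured:
  assumes "finite V" "even (card V)"
    and G: "\<And>m e. m \<in> set w \<Longrightarrow> e \<in> G m \<Longrightarrow> card e = 2"
  shows "(\<Sum>R\<in>perfect_matchings V. real (num_coloured G R w))
           = factorial_moment G V w * card (perfect_matchings V)"
  using assms
proof (induction w arbitrary: V)
  case Nil
  then show ?case by simp
next
  case (Cons m w)
  define E where "E = {e \<in> G m. e \<subseteq> V}"
  have E: "finite E" "\<And>e. e \<in> E \<Longrightarrow> e \<subseteq> V \<and> card e = 2"
    using Cons.prems by (auto simp: E_def)
  have "(\<Sum>R\<in>perfect_matchings V. real (num_coloured G R (m # w)))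
      = (\<Sum>R\<in>perfect_matchings V. \<Sum>e\<in>{e \<in> E. e \<in> R}. real (num_coloured G (R - {e}) w))"
    by (intro sum.cong refl) (auto simp: E_def perfect_matchings_def intro!: sum.cong)
  also have "\<dots> = (\<Sum>e\<in>E. \<Sum>R\<in>{R \<in> perfect_matchings V. e \<in> R}. real (num_coloured G (R - {e}) w))"
    using Cons.prems E by (intro sum.swap_restrict finite_perfect_matchings)
  also have "\<dots> = (\<Sum>e\<in>E. factorial_moment G (V - e) w * (card (perfect_matchings V) / (real (card V) - 1)))"
  proof (rule sum.cong[OF refl])
    fix e assume "e \<in> E"
    then have e: "e \<subseteq> V" "card e = 2" "finite e" using E Cons.prems finite_subset by blast+
    then have "card e \<le> card V" using Cons.prems card_mono by blast
    then obtain k where k: "card V = 2 * Suc k"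
      using Cons.prems(2) e by (metis Suc_diff_1 evenE le_zero_eq mult_is_0 not_gr_zero zero_neq_numeral)
    have c: "card (V - e) = 2 * k" using e k by (simp add: card_Diff_subset)
    have "(\<Sum>R\<in>{R \<in> perfect_matchings V. e \<in> R}. real (num_coloured G (R - {e}) w))
        = (\<Sum>R\<in>perfect_matchings (V - e). real (num_coloured G R w))"
      using sum.reindex_bij_betw[OF bij_betw_remove_edge[OF e(1,2)]] by auto
    also have "\<dots> = factorial_moment G (V - e) w * card (perfect_matchings (V - e))"
      using Cons.prems c by (intro Cons.IH) auto
    \<comment> \<open>The two double factorials differ by the last factor \<open>2 * k + 1\<close>,
      which is \<open>card V - 1\<close>, the denominator in
      \<open>factorial_moment\<close>.\<close>
    also have "real (card (perfect_matchings (V - e))) = card (perfect_matchings V) / (real (card V) - 1)"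
    proof -
      have "card (perfect_matchings V) = card (perfect_matchings (V - e)) * (2 * k + 1)"
        using Cons.prems k c
        by (simp add: card_perfect_matchings[of _ k] card_perfect_matchings[of _ "Suc k"])
      moreover have "real (card V) - 1 = real (2 * k + 1)" using k by simp
      ultimately show ?thesis by (simp only: of_nat_mult) simp
    qed
    finally show "(\<Sum>R\<in>{R \<in> perfect_matchings V. e \<in> R}. real (num_coloured G (R - {e}) w))
        = factorial_moment G (V - e) w * (card (perfect_matchings V) / (real (card V) - 1))" .
  qed
  also have "\<dots> = factorial_moment G V (m # w) * card (perfect_matchings V)"
    by (simp add: E_def sum_distrib_right sum_divide_distrib)
  finally show ?case .
qed

text \<open>Picking \<open>count_list w m\<close> distinct edges of colour \<open>m\<close> in order
  gives a falling factorial. Disjoint colour classes do not compete for edges, so these counts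
  multiply whatever the order of the letters.\<close>

lemma num_coloured_eq_prod:
  assumes "finite I" "set w \<subseteq> I" "disjoint_family_on G I" "finite R"
  shows "num_coloured G R w
           = (\<Prod>m\<in>I. fact (count_list w m) * (card (G m \<inter> R) choose count_list w m))"
  using assms(2,4)
proof (induction w arbitrary: R)
  case Nil
  then show ?case by simp
next
  case (Cons m w)
  let ?c = "count_list w"
  let ?P = "\<Prod>i\<in>I - {m}. fact (?c i) * (card (G i \<inter> R) choose ?c i)"
  have m: "m \<in> I" using Cons.prems by simp
  have "num_coloured G R (m # w) =
      (\<Sum>e\<in>G m \<inter> R. fact (?c m) * ((card (G m \<inter> R) - 1) choose ?c m) * ?P)"
    unfolding num_coloured.simps
  proof (rule sum.cong[OF refl])
    fix e assume e: "e \<in> G m \<inter> R"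
    \<comment> \<open>Disjointness enters here: an edge of colour \<open>m\<close> has no other
      colour in \<open>I\<close>, so removing it lowers one count only.\<close>
    have "G i \<inter> (R - {e}) = G i \<inter> R" if "i \<in> I - {m}" for i
      using that e m assms(3) by (auto simp: disjoint_family_on_def)
    moreover have "G m \<inter> (R - {e}) = G m \<inter> R - {e}" by auto
    moreover have "num_coloured G (R - {e}) w
        = (\<Prod>i\<in>I. fact (?c i) * (card (G i \<inter> (R - {e})) choose ?c i))"
      using Cons by (intro Cons.IH) auto
    ultimately show "num_coloured G (R - {e}) w
        = fact (?c m) * ((card (G m \<inter> R) - 1) choose ?c m) * ?P"
      using e Cons.prems by (subst (asm) prod.remove[OF assms(1) m]) simp
  qed
  also have "\<dots> = fact (?c m) * (card (G m \<inter> R) * ((card (G m \<inter> R) - 1) choose ?c m)) * ?P"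
    by simp
  \<comment> \<open>Absorption: \<open>n * ((n - 1) choose c)\<close> equals
    \<open>Suc c * (n choose Suc c)\<close>, and the new factor \<open>Suc c\<close> extends the
    factorial.\<close>
  also have "\<dots> = fact (Suc (?c m)) * (card (G m \<inter> R) choose Suc (?c m)) * ?P"
    unfolding binomial_absorption[symmetric] fact_Suc by (simp add: algebra_simps)
  also have "\<dots> = (\<Prod>i\<in>I. fact (count_list (m # w) i) * (card (G i \<inter> R) choose count_list (m # w) i))"
  proof -
    have "?P = (\<Prod>i\<in>I - {m}. fact (count_list (m # w) i) * (card (G i \<inter> R) choose count_list (m # w) i))"
      by (intro prod.cong) auto
    then show ?thesis
      unfolding prod.remove[OF assms(1) m] by simp
  qed
  finally show ?case .
qed

section \<open>Total variation distance and binomial moments\<close>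

text \<open>The weight comes from the coefficients: for fixed \<open>j\<close> the absolute values
  of \<open>u k j\<close> are products of binomial coefficients, and each full row sums to
  \<open>2 ^ j m\<close>. The rest is the triangle inequality and an exchange of sums.\<close>

lemma d_TV_le_moments:
  fixes S T :: "(nat \<Rightarrow> nat) \<Rightarrow> real" and l :: nat
  defines "u \<equiv> \<lambda>k j. \<Prod>m\<in>{1..l}. (-1) ^ (j m + k m) * real (j m choose k m)"
  assumes P: "\<And>k. k \<in> nat_vectors l \<Longrightarrow> ((\<lambda>j. u k j * S j) has_sum pmf P k) (nat_vectors l)"
    and Q: "\<And>k. k \<in> nat_vectors l \<Longrightarrow> ((\<lambda>j. u k j * T j) has_sum pmf Q k) (nat_vectors l)"
    and summ: "(\<lambda>j. 2 ^ (\<Sum>m\<in>{1..l}. j m) * \<bar>S j - T j\<bar>) summable_on nat_vectors l"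
  shows "d_TV l P Q \<le> (\<Sum>\<^sub>\<infinity>j\<in>nat_vectors l. 2 ^ (\<Sum>m\<in>{1..l}. j m) * \<bar>S j - T j\<bar>)"
  unfolding d_TV_def
\<comment> \<open>Bounding all finite partial sums suffices, so the later exchange is between a
  finite and an infinite sum.\<close>
proof (rule infsum_le_finite_sums[OF d_TV_summable])
  fix K assume K: "finite K" "K \<subseteq> nat_vectors l"
  \<comment> \<open>Stated for every finite \<open>K\<close>, not only the fixed one: the singleton
    \<open>{k}\<close> bounds a single coefficient and yields the summability in
    \<open>summ'\<close>.\<close>
  have absu: "(\<Sum>k\<in>K. \<bar>u k j\<bar>) \<le> 2 ^ (\<Sum>m\<in>{1..l}. j m)" if "finite K" "K \<subseteq> nat_vectors l" for K j
  proof -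
    have uabs: "\<bar>u k j\<bar> = (\<Prod>m\<in>{1..l}. real (j m choose k m))" for k
      by (simp add: u_def abs_prod abs_mult power_abs)
    let ?B = "PiE {1..l} (\<lambda>m. {..j m})"
    have fin: "finite ?B" by (intro finite_PiE) auto
    \<comment> \<open>A coefficient vanishes as soon as some \<open>k m\<close> exceeds
      \<open>j m\<close>, so only the finite box \<open>?B\<close> contributes.\<close>
    have z: "\<bar>u k j\<bar> = 0" if "k \<in> K - ?B" for k
    proof -
      from that \<open>K \<subseteq> nat_vectors l\<close> have "k \<in> nat_vectors l" "k \<notin> ?B" by auto
      then obtain m where "m \<in> {1..l}" "j m < k m"
        by (auto simp: nat_vectors_def PiE_iff not_le)
      then show ?thesis unfolding uabs by (intro prod_zero) (auto intro!: bexI[of _ m])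
    qed
    have "(\<Sum>k\<in>K. \<bar>u k j\<bar>) = (\<Sum>k\<in>K \<inter> ?B. \<bar>u k j\<bar>)"
      using that z by (intro sum.mono_neutral_right) auto
    also have "\<dots> \<le> (\<Sum>k\<in>?B. \<bar>u k j\<bar>)"
      using fin by (intro sum_mono2) auto
    also have "\<dots> = (\<Prod>m\<in>{1..l}. \<Sum>i\<le>j m. real (j m choose i))"
      unfolding uabs by (subst prod_sum_PiE) auto
    also have "\<dots> = (\<Prod>m\<in>{1..l}. 2 ^ j m)"
    proof (intro prod.cong refl)
      fix m
      have "(\<Sum>i\<le>j m. real (j m choose i)) = real (\<Sum>i\<le>j m. (j m choose i))" by simp
      then show "(\<Sum>i\<le>j m. real (j m choose i)) = 2 ^ j m" by (simp add: choose_row_sum)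
    qed
    finally show ?thesis by (simp add: power_sum)
  qed
  have diff: "((\<lambda>j. u k j * (S j - T j)) has_sum (pmf P k - pmf Q k)) (nat_vectors l)" if "k \<in> K" for k
    using has_sum_add[OF P has_sum_cmult_right[OF Q, of _ "-1"], of k k] that K by (auto simp: algebra_simps)
  have summ': "(\<lambda>j. \<bar>u k j\<bar> * \<bar>S j - T j\<bar>) summable_on nat_vectors l" if "k \<in> K" for k
    using absu[of "{k}"] that K
    by (intro summable_on_comparison_test[OF summ]) (auto intro!: mult_right_mono)
  have "\<bar>pmf P k - pmf Q k\<bar> \<le> (\<Sum>\<^sub>\<infinity>j\<in>nat_vectors l. \<bar>u k j\<bar> * \<bar>S j - T j\<bar>)" if "k \<in> K" for k
    using norm_infsum_le[OF diff has_sum_infsum[OF summ']] that by (simp add: abs_mult)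
  then have "(\<Sum>k\<in>K. \<bar>pmf P k - pmf Q k\<bar>) \<le> (\<Sum>k\<in>K. \<Sum>\<^sub>\<infinity>j\<in>nat_vectors l. \<bar>u k j\<bar> * \<bar>S j - T j\<bar>)"
    by (rule sum_mono)
  also have "\<dots> = (\<Sum>\<^sub>\<infinity>j\<in>nat_vectors l. \<Sum>k\<in>K. \<bar>u k j\<bar> * \<bar>S j - T j\<bar>)"
    using summ' by (intro infsumI[symmetric] has_sum_sum has_sum_infsum) auto
  also have "\<dots> \<le> (\<Sum>\<^sub>\<infinity>j\<in>nat_vectors l. 2 ^ (\<Sum>m\<in>{1..l}. j m) * \<bar>S j - T j\<bar>)"
    using summ' summ absu[OF K]
    by (intro infsum_mono has_sum_sum[THEN has_sum_imp_summable, OF has_sum_infsum]) (auto simp flip: sum_distrib_right intro!: mult_right_mono)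
  finally show "(\<Sum>k\<in>K. \<bar>pmf P k - pmf Q k\<bar>) \<le> (\<Sum>\<^sub>\<infinity>j\<in>nat_vectors l. 2 ^ (\<Sum>m\<in>{1..l}. j m) * \<bar>S j - T j\<bar>)" .
qed

subsection \<open>Factorial moments under a degree bound\<close>

text \<open>The situation for one \<open>n\<close>, with \<open>G m\<close> the edges of colour
  \<open>m\<close>. The degree bound ranges over every \<open>v\<close> of the type; outside
  \<open>V\<close> it is trivial because edges lie in \<open>V\<close>.\<close>

locale bounded_degree_family =
  fixes G :: "'c \<Rightarrow> 'a set set" and V :: "'a set" and C :: nat and I :: "'c set"
  assumes finite_V: "finite V"
    and edge: "\<And>m e. m \<in> I \<Longrightarrow> e \<in> G m \<Longrightarrow> e \<subseteq> V \<and> card e = 2"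
    and degree: "\<And>m v. m \<in> I \<Longrightarrow> card {e \<in> G m. v \<in> e} \<le> C"
begin

lemma finite_edges: "m \<in> I \<Longrightarrow> finite (G m)"
  using finite_V edge by (intro finite_subset[of "G m" "Pow V"]) auto

text \<open>Handshake argument in the subgraph induced on \<open>U\<close>: the incidences of
  vertices and edges are counted in two ways.\<close>

lemma card_edges_within:
  assumes "m \<in> I" "finite U"
  shows "2 * card {e \<in> G m. e \<subseteq> U} \<le> C * card U"
proof -
  let ?E = "{e \<in> G m. e \<subseteq> U}"
  have fin: "finite ?E" using finite_edges assms by simp
  have "2 * card ?E = (\<Sum>e\<in>?E. card e)"
    using edge assms by simp
  also have "\<dots> = (\<Sum>e\<in>?E. \<Sum>v\<in>{v \<in> U. v \<in> e}. 1)"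
    by (intro sum.cong refl) (simp add: Collect_conj_eq Int_absorb1)
  also have "\<dots> = (\<Sum>v\<in>U. \<Sum>e\<in>{e \<in> ?E. v \<in> e}. 1)"
    using fin assms(2) by (rule sum.swap_restrict)
  also have "\<dots> \<le> (\<Sum>v\<in>U. C)"
  proof (rule sum_mono)
    fix v
    have "card {e \<in> ?E. v \<in> e} \<le> card {e \<in> G m. v \<in> e}"
      using finite_edges assms by (intro card_mono) auto
    then show "(\<Sum>e\<in>{e \<in> ?E. v \<in> e}. 1) \<le> C"
      using degree[OF assms(1), of v] by simp
  qed
  finally show ?thesis by (simp add: mult.commute)
qed

lemma card_edges_total: "m \<in> I \<Longrightarrow> 2 * card (G m) \<le> C * card V"
proof -
  assume m: "m \<in> I"
  then have "{e \<in> G m. e \<subseteq> V} = G m" using edge by auto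
  then show ?thesis using card_edges_within[OF m finite_V] by simp
qed

text \<open>Every lost edge has an end in \<open>V - U\<close>, and each such vertex accounts for at
  most \<open>C\<close> edges.\<close>

lemma card_edges_deleted:
  assumes "m \<in> I" "U \<subseteq> V"
  shows "card (G m) \<le> card {e \<in> G m. e \<subseteq> U} + C * card (V - U)"
proof -
  have "G m \<subseteq> {e \<in> G m. e \<subseteq> U} \<union> (\<Union>v\<in>V - U. {e \<in> G m. v \<in> e})"
    using edge assms by blast
  then have "card (G m) \<le> card ({e \<in> G m. e \<subseteq> U} \<union> (\<Union>v\<in>V - U. {e \<in> G m. v \<in> e}))"
    using finite_edges assms finite_V by (intro card_mono) auto
  also have "\<dots> \<le> card {e \<in> G m. e \<subseteq> U} + card (\<Union>v\<in>V - U. {e \<in> G m. v \<in> e})"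
    by (rule card_Un_le)
  also have "card (\<Union>v\<in>V - U. {e \<in> G m. v \<in> e}) \<le> (\<Sum>v\<in>V - U. card {e \<in> G m. v \<in> e})"
    using finite_V by (intro card_UN_le) auto
  also have "\<dots> \<le> (\<Sum>v\<in>V - U. C)"
    using degree assms by (intro sum_mono) auto
  finally show ?thesis by (simp add: mult.commute)
qed

text \<open>The left side is the expected number of edges of colour \<open>m\<close> in a uniform
  perfect matching of \<open>U\<close>. The handshake bound \<open>C * card U / 2\<close> is at most
  \<open>C * (card U - 1)\<close> because \<open>card U \<ge> 2\<close>.\<close>

lemma edge_density_le:
  assumes "m \<in> I" "finite U" "even (card U)" "card U > 0"
  shows "real (card {e \<in> G m. e \<subseteq> U}) / (real (card U) - 1) \<le> C"
proof -
  have "real (2 * card {e \<in> G m. e \<subseteq> U}) \<le> real (C * card U)"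
    using card_edges_within[OF assms(1,2)] by (simp only: of_nat_le_iff)
  moreover have u: "card U \<ge> 2" using assms(3,4) by (auto elim!: evenE)
  then have "real C * real (card U) \<le> real C * (2 * (real (card U) - 1))"
    by (intro mult_left_mono) auto
  ultimately have "real (card {e \<in> G m. e \<subseteq> U}) \<le> C * (real (card U) - 1)"
    by (simp add: algebra_simps)
  then show ?thesis using u by (simp add: pos_divide_le_eq)
qed

text \<open>Each letter contributes an edge density, at most \<open>C\<close> in every remaining
  vertex set, times an average of moments of the shorter word.\<close>

lemma factorial_moment_bounds:
  assumes "set w \<subseteq> I" "U \<subseteq> V" "even (card U)"
  shows "0 \<le> factorial_moment G U w \<and> factorial_moment G U w \<le> real C ^ length w"
  using assms
proof (induction w arbitrary: U)
  case Nil
  then show ?case by simp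
next
  case (Cons m w)
  let ?E = "{e \<in> G m. e \<subseteq> U}"
  have m: "m \<in> I" and U: "finite U" using Cons.prems finite_V finite_subset by auto
  show ?case
  proof (cases "card U = 0")
    \<comment> \<open>For \<open>U = {}\<close> the denominator is -1, but no edge fits into
      \<open>U\<close>, so the empty sum makes the moment 0.\<close>
    case True
    then have "U = {}" using U by simp
    then have "?E = {}" using edge[OF m] by fastforce
    then show ?thesis by (simp del: Collect_empty_eq)
  next
    case False
    have IH: "0 \<le> factorial_moment G (U - e) w" "factorial_moment G (U - e) w \<le> real C ^ length w"
      if "e \<in> ?E" for e
    proof -
      have "card (U - e) = card U - 2"
        using that edge[OF m, of e] U finite_subset[of e U] by (simp add: card_Diff_subset)
      then show "0 \<le> factorial_moment G (U - e) w" "factorial_moment G (U - e) w \<le> real C ^ length w"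
        using Cons.IH[of "U - e"] Cons.prems by auto
    qed
    have pos: "0 \<le> real (card U) - 1" using False by simp
    have "(\<Sum>e\<in>?E. factorial_moment G (U - e) w) \<le> (\<Sum>e\<in>?E. real C ^ length w)"
      using IH by (intro sum_mono) auto
    then have "factorial_moment G U (m # w) \<le> (card ?E * real C ^ length w) / (real (card U) - 1)"
      using pos by (auto intro: divide_right_mono)
    also have "\<dots> = (card ?E / (real (card U) - 1)) * real C ^ length w" by simp
    also have "\<dots> \<le> C * real C ^ length w"
      using edge_density_le[OF m U] Cons.prems False by (intro mult_right_mono) auto
    finally show ?thesis using IH pos by (auto intro!: divide_nonneg_nonneg sum_nonneg)
  qed
qed

end

lemma abs_triangle_half:
  fixes x y z e :: real
  shows "\<bar>x - y\<bar> \<le> e / 2 \<Longrightarrow> \<bar>y - z\<bar> \<le> e / 2 \<Longrightarrow> \<bar>x - z\<bar> \<le> e"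
  by linarith

text \<open>Here \<open>g\<close> is the number of edges in all, \<open>a\<close> the number left
  inside the \<open>u\<close> remaining vertices, and \<open>s\<close> bounds the number of deleted
  vertices. Comparing through \<open>g / (u - 1)\<close>, the change of numerator costs
  \<open>c * s / (u - 1)\<close> and the change of denominator
  \<open>c * (s + 1) / (u - 1)\<close>.\<close>

lemma edge_density_error:
  fixes a g c n s u :: real
  assumes "a \<le> g" "g \<le> a + c * s" "0 \<le> a" "g \<le> c * n" "u \<le> 2 * n" "2 * n \<le> u + s" "u > 1" "0 \<le> s" "0 \<le> c"
  shows "\<bar>a / (u - 1) - g / (2 * n)\<bar> \<le> 2 * c * (s + 1) / (u - 1)"
proof -
  have n: "n > 0" using assms by linarith
  have "\<bar>a / (u - 1) - g / (u - 1)\<bar> = (g - a) / (u - 1)"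
    using assms by (simp add: diff_divide_distrib[symmetric] abs_divide)
  also have "\<dots> \<le> c * s / (u - 1)"
    using assms by (intro divide_right_mono) auto
  finally have 1: "\<bar>a / (u - 1) - g / (u - 1)\<bar> \<le> c * s / (u - 1)" .
  have "g / (u - 1) - g / (2 * n) = (g / (2 * n)) * ((2 * n - (u - 1)) / (u - 1))"
    using assms n by (simp add: field_simps)
  then have eq: "\<bar>g / (u - 1) - g / (2 * n)\<bar> = \<bar>g / (2 * n)\<bar> * \<bar>(2 * n - (u - 1)) / (u - 1)\<bar>"
    by (simp only: abs_mult)
  have g: "g / (2 * n) \<le> c" "0 \<le> g / (2 * n)"
    using assms n by (auto simp: divide_le_eq intro: order_trans[OF assms(4)])
  have q: "0 \<le> (2 * n - (u - 1)) / (u - 1)" "(2 * n - (u - 1)) / (u - 1) \<le> (s + 1) / (u - 1)"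
    using assms by (auto intro!: divide_right_mono)
  have 2: "\<bar>g / (u - 1) - g / (2 * n)\<bar> \<le> c * ((s + 1) / (u - 1))"
    unfolding eq abs_of_nonneg[OF g(2)] abs_of_nonneg[OF q(1)] using g q assms(9) by (intro mult_mono)
  have "c * s / (u - 1) \<le> c * (s + 1) / (u - 1)"
    using assms by (intro divide_right_mono mult_left_mono) auto
  then show ?thesis using 1 2 by (simp add: abs_le_iff)
qed

text \<open>Deleting boundedly many vertices changes neither the number of edges nor the number of
  vertices to first order, so each factor of the recursion is asymptotically the edge density.\<close>

lemma factorial_moment_approx:
  fixes G :: "nat \<Rightarrow> 'c \<Rightarrow> 'a set set" and V :: "nat \<Rightarrow> 'a set"
  assumes fam: "\<And>n. n \<ge> 1 \<Longrightarrow> bounded_degree_family (G n) (V n) C I"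
    and V: "\<And>n. card (V n) = 2 * n"
    and w: "set w \<subseteq> I" and \<epsilon>: "\<epsilon> > 0"
  shows "\<forall>\<^sub>F n in sequentially. \<forall>U. U \<subseteq> V n \<longrightarrow> even (card U) \<longrightarrow> card (V n - U) \<le> s \<longrightarrow>
           \<bar>factorial_moment (G n) U w - (\<Prod>m\<leftarrow>w. card (G n m) / (2 * real n))\<bar> \<le> \<epsilon>"
  using w \<epsilon>
proof (induction w arbitrary: s \<epsilon>)
  case Nil
  then show ?case by simp
next
  case (Cons m w)
  \<comment> \<open>The density error of \<open>edge_density_error\<close> times the bound
    \<open>C ^ length w\<close> on the remaining product; dividing by \<open>n\<close> uses
    \<open>card U - 1 \<ge> n\<close>.\<close>
  define K where "K = 2 * real C * (real s + 1) * real C ^ length w"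
  have m: "m \<in> I" and w: "set w \<subseteq> I" using Cons.prems by auto
  \<comment> \<open>The tolerance leaves at most \<open>\<epsilon> / 2\<close> after multiplication
    by a density of at most \<open>C\<close>; the summand 1 covers \<open>C = 0\<close>. The
    parameter \<open>s + 2\<close> below allows for the two ends of the edge removed next.\<close>
  have "\<epsilon> / (2 * (real C + 1)) > 0" using Cons.prems by simp
  from Cons.IH[OF w this, of "s + 2"]
  have ev1: "\<forall>\<^sub>F n in sequentially. \<forall>U. U \<subseteq> V n \<longrightarrow> even (card U) \<longrightarrow> card (V n - U) \<le> s + 2 \<longrightarrow>
    \<bar>factorial_moment (G n) U w - (\<Prod>m\<leftarrow>w. card (G n m) / (2 * real n))\<bar> \<le> \<epsilon> / (2 * (real C + 1))" .
  have "(\<lambda>n. K / real n) \<longlonglongrightarrow> 0" by (rule lim_const_over_n)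
  then have ev2: "\<forall>\<^sub>F n in sequentially. K / real n < \<epsilon> / 2"
    using Cons.prems by (intro order_tendstoD) auto
  show ?case
    using ev1 ev2 eventually_ge_at_top[of "s + 1"]
  proof eventually_elim
    case (elim n)
    then have n: "n \<ge> 1" by simp
    interpret bounded_degree_family "G n" "V n" C I using fam n by simp
    define p where "p = (\<Prod>m\<leftarrow>w. card (G n m) / (2 * real n))"
    have p: "0 \<le> p \<and> p \<le> real C ^ length w"
      unfolding p_def using w
    proof (induction w)
      case (Cons m' w')
      have "2 * card (G n m') \<le> C * (2 * n)" using card_edges_total[of m'] V Cons.prems by simp
      then have "real (card (G n m')) \<le> real C * real n"
        by (metis mult.left_commute mult_le_cancel1 of_nat_le_iff of_nat_mult zero_less_numeral)
      also have "\<dots> \<le> real C * (2 * real n)" by (intro mult_left_mono) auto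
      finally have "card (G n m') / (2 * real n) \<le> C" using n by (simp add: divide_le_eq)
      moreover have "0 \<le> (\<Prod>m\<leftarrow>w'. card (G n m) / (2 * real n))"
        "(\<Prod>m\<leftarrow>w'. card (G n m) / (2 * real n)) \<le> real C ^ length w'"
        using Cons by auto
      ultimately have "card (G n m') / (2 * real n) * (\<Prod>m\<leftarrow>w'. card (G n m) / (2 * real n))
          \<le> real C * real C ^ length w'"
        by (intro mult_mono) auto
      then show ?case using \<open>0 \<le> (\<Prod>m\<leftarrow>w'. card (G n m) / (2 * real n))\<close> by simp
    qed simp
    show ?case
    proof (intro allI impI)
      fix U assume U: "U \<subseteq> V n" "even (card U)" "card (V n - U) \<le> s"
      let ?E = "{e \<in> G n m. e \<subseteq> U}"
      have finU: "finite U" using U finite_V finite_subset by blast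
      have cU: "card U \<le> 2 * n" "2 * n \<le> card U + s"
        using U V[of n] card_Diff_subset[OF finU U(1)] card_mono[OF finite_V U(1)] by auto
      \<comment> \<open>Follows from \<open>n \<ge> s + 1\<close> and keeps the denominator at least
        \<open>n\<close>, uniformly in \<open>U\<close>.\<close>
      have un: "n \<le> real (card U) - 1" using cU elim(3) by linarith
      define d where "d = \<epsilon> / (2 * (real C + 1))"
      have "d > 0" using Cons.prems by (simp add: d_def)
      have IH: "\<bar>factorial_moment (G n) (U - e) w - p\<bar> \<le> d" if "e \<in> ?E" for e
      proof -
        have e: "e \<subseteq> U" "card e = 2" "finite e" using that edge[OF m, of e] finU finite_subset by auto
        have "card (U - e) = card U - 2" using e by (simp add: card_Diff_subset)
        moreover have "V n - (U - e) = (V n - U) \<union> e" using e U by auto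
        then have "card (V n - (U - e)) \<le> s + 2" using card_Un_le[of "V n - U" e] e U by simp
        moreover have "U - e \<subseteq> V n" "even (card U - 2)" using U by auto
        ultimately show ?thesis
          unfolding p_def d_def using elim(1)[rule_format, of "U - e"] by simp
      qed
      let ?a = "card ?E / (real (card U) - 1)"
      have a: "0 \<le> ?a" "?a \<le> C" using edge_density_le[OF m finU U(2)] un n by auto
      \<comment> \<open>First error: the moments left after removing an edge are all replaced by the
        common value \<open>p\<close>.\<close>
      have "factorial_moment (G n) U (m # w) - ?a * p
          = (\<Sum>e\<in>?E. factorial_moment (G n) (U - e) w - p) / (real (card U) - 1)"
        by (simp add: sum_subtractf diff_divide_distrib)
      also have "\<bar>\<dots>\<bar> \<le> (\<Sum>e\<in>?E. d) / (real (card U) - 1)"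
        unfolding abs_divide using un n IH
        by (intro frac_le order_trans[OF sum_abs] sum_mono) (auto intro!: mult_nonneg_nonneg less_imp_le[OF \<open>d > 0\<close>])
      also have "\<dots> = ?a * d" by simp
      also have "\<dots> \<le> C * d" using a \<open>d > 0\<close> by (intro mult_right_mono) auto
      also have "\<dots> \<le> \<epsilon> / 2"
        using Cons.prems by (simp add: d_def field_simps)
      finally have 1: "\<bar>factorial_moment (G n) U (m # w) - ?a * p\<bar> \<le> \<epsilon> / 2" .
      \<comment> \<open>Second error: the density inside \<open>U\<close> is replaced by the global
        one.\<close>
      have dens: "\<bar>?a - card (G n m) / (2 * real n)\<bar> \<le> 2 * real C * (real s + 1) / (real (card U) - 1)"
      proof (rule edge_density_error)
        show "real (card ?E) \<le> card (G n m)" using finite_edges[OF m] by (intro of_nat_mono card_mono) auto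
        have "card (G n m) \<le> card ?E + C * card (V n - U)" by (rule card_edges_deleted[OF m U(1)])
        also have "\<dots> \<le> card ?E + C * s" using U(3) by simp
        finally show "real (card (G n m)) \<le> real (card ?E) + real C * real s"
          by (metis of_nat_add of_nat_le_iff of_nat_mult)
        have "2 * card (G n m) \<le> C * (2 * n)" using card_edges_total[OF m] V by simp
        then show "real (card (G n m)) \<le> real C * real n"
          by (metis mult.left_commute mult_le_cancel1 of_nat_le_iff of_nat_mult zero_less_numeral)
      qed (use cU un n in auto)
      also have "\<dots> \<le> 2 * real C * (real s + 1) / n"
        using un n by (intro divide_left_mono) auto
      finally have "\<bar>?a - card (G n m) / (2 * real n)\<bar> * p \<le> 2 * real C * (real s + 1) / n * real C ^ length w"
        using p by (intro mult_mono) auto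
      also have "\<dots> = K / n" by (simp add: K_def)
      finally have "\<bar>?a * p - card (G n m) / (2 * real n) * p\<bar> \<le> \<epsilon> / 2"
        using elim(2) p by (simp only: left_diff_distrib[symmetric] abs_mult abs_of_nonneg)
      then have "\<bar>factorial_moment (G n) U (m # w) - card (G n m) / (2 * real n) * p\<bar> \<le> \<epsilon>"
        by (rule abs_triangle_half[OF 1])
      then show "\<bar>factorial_moment (G n) U (m # w) - (\<Prod>m\<leftarrow>m # w. card (G n m) / (2 * real n))\<bar> \<le> \<epsilon>"
        by (simp add: p_def)
    qed
  qed
qed

subsection \<open>Moments of the two laws\<close>

lemma perfect_matching_complete_iff:
  "perfect_matching M (complete_nat_graph N) \<longleftrightarrow>
     verts M = {..<N} \<and> edges M \<in> perfect_matchings {..<N}"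
  by (auto simp: perfect_matching_def subgraph_def simple_graph_def complete_nat_graph_def
      perfect_matchings_def)

definition edge_counts :: "nat \<Rightarrow> (nat \<Rightarrow> nat set set) \<Rightarrow> nat set set \<Rightarrow> nat \<Rightarrow> nat" where
  "edge_counts l G R = (\<lambda>m\<in>{1..l}. card (R \<inter> G m))"

text \<open>A perfect matching is determined by its edge set, so \<open>edges\<close> is injective
  on perfect matchings and carries the uniform law to the uniform law.\<close>

lemma law_X_eq:
  "law_X l n D = map_pmf (edge_counts l (\<lambda>m. edges (D m))) (pmf_of_set (perfect_matchings {..<2 * n}))"
proof -
  have img: "edges ` {M. perfect_matching M (complete_nat_graph (2 * n))} = perfect_matchings {..<2 * n}"
    by (force simp: perfect_matching_complete_iff image_iff)
  have inj: "inj_on edges {M. perfect_matching M (complete_nat_graph (2 * n))}"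
    by (intro inj_onI prod_eqI) (auto simp: perfect_matching_complete_iff)
  show ?thesis
    unfolding law_X_def uniform_perfect_matching_def img[symmetric]
      map_pmf_of_set_inj[OF inj perfect_matchings_complete_nat_graph(2,1), symmetric]
    by (simp add: map_pmf_comp edge_counts_def graph_inter_def)
qed

lemma pmf_map_pmf_of_set:
  assumes "finite A" "A \<noteq> {}"
  shows "pmf (map_pmf f (pmf_of_set A)) y = (\<Sum>x\<in>A. of_bool (f x = y)) / card A"
proof -
  have "pmf (map_pmf f (pmf_of_set A)) y = measure (pmf_of_set A) (f -` {y})"
    by (rule pmf_map)
  also have "\<dots> = card (A \<inter> f -` {y}) / card A"
    using assms by (simp add: measure_pmf_of_set)
  also have "real (card (A \<inter> f -` {y})) = (\<Sum>x\<in>A. of_bool (f x = y))"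
    using assms by (simp add: of_bool_def sum.If_cases vimage_def Int_def)
  finally show ?thesis .
qed

definition binomial_moment :: "nat \<Rightarrow> nat \<Rightarrow> (nat \<Rightarrow> nat set set) \<Rightarrow> (nat \<Rightarrow> nat) \<Rightarrow> real" where
  "binomial_moment l n G j =
     (\<Sum>R\<in>perfect_matchings {..<2 * n}. \<Prod>m\<in>{1..l}. real (edge_counts l G R m choose j m))
       / card (perfect_matchings {..<2 * n})"

definition poisson_moment :: "nat \<Rightarrow> nat \<Rightarrow> (nat \<Rightarrow> nat set set) \<Rightarrow> (nat \<Rightarrow> nat) \<Rightarrow> real" where
  "poisson_moment l n G j =
     (\<Prod>m\<in>{1..l}. (card (G m) / (2 * real n)) ^ j m / fact (j m))"

text \<open>For each matching \<open>R\<close> the inversion formula for indicators is multiplied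
  over the components; averaging over \<open>R\<close> gives the law of the counts.\<close>

lemma has_sum_law_X:
  assumes "k \<in> nat_vectors l"
  shows "((\<lambda>j. (\<Prod>m\<in>{1..l}. (-1) ^ (j m + k m) * real (j m choose k m))
            * binomial_moment l n (\<lambda>m. edges (D m)) j)
          has_sum pmf (law_X l n D) k) (nat_vectors l)"
proof -
  let ?G = "\<lambda>m. edges (D m)" and ?P = "perfect_matchings {..<2 * n}"
  have P: "finite ?P" "?P \<noteq> {}"
    using finite_perfect_matchings[of "{..<2 * n}"] card_perfect_matchings_pos[of "{..<2 * n}"] by auto
  \<comment> \<open>Both vectors are extensional on \<open>{1..l}\<close>, so agreement of the
    coordinates there is equality of functions.\<close>
  have eq: "(\<Prod>m\<in>{1..l}. of_bool (edge_counts l ?G R m = k m)) = (of_bool (edge_counts l ?G R = k) :: real)" for R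
  proof -
    have "edge_counts l ?G R = k \<longleftrightarrow> (\<forall>m\<in>{1..l}. edge_counts l ?G R m = k m)"
    proof
      assume "\<forall>m\<in>{1..l}. edge_counts l ?G R m = k m"
      then show "edge_counts l ?G R = k"
        using assms by (intro PiE_ext[of _ "{1..l}" "\<lambda>_. UNIV"]) (auto simp: nat_vectors_def edge_counts_def)
    qed auto
    then show ?thesis by (auto simp: of_bool_def prod_zero_iff)
  qed
  have "((\<lambda>j. \<Prod>m\<in>{1..l}. (-1) ^ (j m + k m) * real (j m choose k m) * real (edge_counts l ?G R m choose j m))
      has_sum (\<Prod>m\<in>{1..l}. of_bool (edge_counts l ?G R m = k m))) (nat_vectors l)" for R
    unfolding nat_vectors_def by (intro has_sum_prod_PiE binomial_inversion_indicator) auto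
  then have "((\<lambda>j. \<Sum>R\<in>?P. \<Prod>m\<in>{1..l}. (-1) ^ (j m + k m) * real (j m choose k m) * real (edge_counts l ?G R m choose j m))
      has_sum (\<Sum>R\<in>?P. of_bool (edge_counts l ?G R = k))) (nat_vectors l)"
    unfolding eq by (intro has_sum_sum)
  then have "((\<lambda>j. (\<Sum>R\<in>?P. \<Prod>m\<in>{1..l}. (-1) ^ (j m + k m) * real (j m choose k m) * real (edge_counts l ?G R m choose j m)) * (1 / card ?P))
      has_sum (\<Sum>R\<in>?P. of_bool (edge_counts l ?G R = k)) * (1 / card ?P)) (nat_vectors l)"
    by (rule has_sum_cmult_left)
  then show ?thesis
    by (simp add: law_X_eq pmf_map_pmf_of_set[OF P] binomial_moment_def prod.distrib flip: sum_distrib_left)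
qed

text \<open>Independence makes the point masses products of Poisson masses, and each factor is
  inverted separately; zero rates are covered by \<open>pmf_poisson_nonneg\<close>.\<close>

lemma has_sum_law_Y:
  assumes "k \<in> nat_vectors l"
  shows "((\<lambda>j. (\<Prod>m\<in>{1..l}. (-1) ^ (j m + k m) * real (j m choose k m))
            * poisson_moment l n (\<lambda>m. edges (D m)) j)
          has_sum pmf (law_Y l n D) k) (nat_vectors l)"
proof -
  let ?r = "\<lambda>m. real (card (edges (D m))) / (2 * real n)"
  have "pmf (law_Y l n D) k = (\<Prod>m\<in>{1..l}. pmf (poisson (?r m)) (k m))"
    unfolding law_Y_def using assms by (intro pmf_Pi') (auto simp: nat_vectors_def)
  then have eq: "pmf (law_Y l n D) k = (\<Prod>m\<in>{1..l}. ?r m ^ k m / fact (k m) * exp (- ?r m))"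
    by (simp add: pmf_poisson_nonneg)
  have "((\<lambda>j. \<Prod>m\<in>{1..l}. (-1) ^ (j m + k m) * real (j m choose k m) * (?r m ^ j m / fact (j m)))
      has_sum (\<Prod>m\<in>{1..l}. ?r m ^ k m / fact (k m) * exp (- ?r m))) (nat_vectors l)"
    unfolding nat_vectors_def by (intro has_sum_prod_PiE binomial_inversion_poisson) auto
  then show ?thesis unfolding eq poisson_moment_def prod.distrib by simp
qed

text \<open>Moments are indexed by count vectors, the recursion by words. Any word with the
  prescribed letter counts links the two.\<close>

lemma ex_list_with_counts:
  assumes "finite I"
  shows "\<exists>w. set w \<subseteq> I \<and> (\<forall>m\<in>I. count_list w m = j m)"
  using assms
proof (induction I)
  case (insert i I)
  then obtain w where w: "set w \<subseteq> I" "\<And>m. m \<in> I \<Longrightarrow> count_list w m = j m" by blast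
  have "count_list (replicate a i) m = (if m = i then a else 0)" for a m
    by (induction a) auto
  moreover have "count_list w i = 0" using w insert.hyps by (auto simp: count_list_0_iff)
  ultimately have "\<forall>m\<in>insert i I. count_list (replicate (j i) i @ w) m = j m"
    using w insert.hyps by auto
  moreover have "set (replicate (j i) i @ w) \<subseteq> insert i I" using w by auto
  ultimately show ?case by blast
qed simp

lemma prod_list_map_eq_prod_count:
  fixes f :: "'a \<Rightarrow> 'b::comm_monoid_mult"
  assumes "finite I" "set w \<subseteq> I"
  shows "(\<Prod>m\<leftarrow>w. f m) = (\<Prod>m\<in>I. f m ^ count_list w m)"
  using assms(2)
proof (induction w)
  case (Cons a w)
  then have a: "a \<in> I" by simp
  have "(\<Prod>m\<in>I - {a}. f m ^ count_list (a # w) m) = (\<Prod>m\<in>I - {a}. f m ^ count_list w m)"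
    by (intro prod.cong) auto
  then show ?case
    using Cons unfolding prod.remove[OF assms(1) a] by (simp add: mult.assoc)
qed simp

lemma length_eq_sum_count_list:
  "finite I \<Longrightarrow> set w \<subseteq> I \<Longrightarrow> length w = (\<Sum>m\<in>I. count_list w m)"
  using sum_count_set by metis

text \<open>For each matching the coloured sequences along \<open>w\<close> number the product of
  the binomials times the product of the factorials; averaging over matchings turns their number
  into \<open>factorial_moment\<close>.\<close>

lemma binomial_moment_eq:
  assumes w: "set w \<subseteq> {1..l}" "\<And>m. m \<in> {1..l} \<Longrightarrow> count_list w m = j m"
    and disj: "disjoint_family_on G {1..l}"
    and card2: "\<And>m e. m \<in> {1..l} \<Longrightarrow> e \<in> G m \<Longrightarrow> card e = 2"
  shows "binomial_moment l n G j = factorial_moment G {..<2 * n} w / (\<Prod>m\<in>{1..l}. fact (j m))"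
proof -
  let ?P = "perfect_matchings {..<2 * n}" and ?f = "\<Prod>m\<in>{1..l}. fact (j m) :: real"
  have f: "?f > 0" by (intro prod_pos) auto
  have P: "card ?P > 0" by (intro card_perfect_matchings_pos) auto
  have "(\<Sum>R\<in>?P. \<Prod>m\<in>{1..l}. real (edge_counts l G R m choose j m)) * ?f
      = (\<Sum>R\<in>?P. real (num_coloured G R w))"
    unfolding sum_distrib_right
  proof (rule sum.cong[OF refl])
    fix R assume R: "R \<in> ?P"
    have "real (num_coloured G R w)
        = (\<Prod>m\<in>{1..l}. fact (count_list w m) * real (card (G m \<inter> R) choose count_list w m))"
      by (subst num_coloured_eq_prod[OF _ w(1) disj finite_matching[OF _ R]]) auto
    also have "\<dots> = (\<Prod>m\<in>{1..l}. fact (j m) * real (edge_counts l G R m choose j m))"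
      by (intro prod.cong refl) (auto simp: w edge_counts_def Int_commute)
    finally show "(\<Prod>m\<in>{1..l}. real (edge_counts l G R m choose j m)) * ?f = real (num_coloured G R w)"
      by (simp add: prod.distrib mult.commute)
  qed
  also have "\<dots> = factorial_moment G {..<2 * n} w * card ?P"
    using w card2 by (intro sum_num_coloured) auto
  finally show ?thesis
    unfolding binomial_moment_def using f P by (simp add: field_simps)
qed

text \<open>Supplies the degree bound for every \<open>v\<close>, as
  \<open>bounded_degree_family\<close> demands: a vertex of \<open>H\<close> is covered by the
  supremum, any other lies on no edge.\<close>

lemma card_edges_at_le_max_degree:
  assumes "simple_graph H"
  shows "card {e \<in> edges H. v \<in> e} \<le> max_degree H"
proof (cases "v \<in> verts H")
  case True
  then have "vertex_degree H v \<le> max_degree H"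
    unfolding max_degree_def using assms by (intro cSUP_upper) (auto simp: simple_graph_def)
  then show ?thesis by (simp add: vertex_degree_def)
next
  case False
  then have "{e \<in> edges H. v \<in> e} = {}" using assms by (auto simp: simple_graph_def)
  then show ?thesis by (simp only: card.empty)
qed

section \<open>Convergence of the total variation distance to zero\<close>

theorem theorem3p1:
  fixes l C :: nat and D :: "nat \<Rightarrow> nat \<Rightarrow> nat graph"
  assumes "l \<ge> 1"
    and "\<And>n m. n \<ge> 1 \<Longrightarrow> m \<in> {1..l} \<Longrightarrow> subgraph (D n m) (complete_nat_graph (2 * n))"
    and "\<And>n. n \<ge> 1 \<Longrightarrow> disjoint_family_on (\<lambda>m. edges (D n m)) {1..l}"
    and "\<And>n m. n \<ge> 1 \<Longrightarrow> m \<in> {1..l} \<Longrightarrow> max_degree (D n m) \<le> C"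
  shows "(\<lambda>n. d_TV l (law_X l n (D n)) (law_Y l n (D n))) \<longlonglongrightarrow> 0"
proof -
  define G where "G = (\<lambda>n m. edges (D n m))"
  define h where "h = (\<lambda>n j. 2 ^ (\<Sum>m\<in>{1..l}. j m) * \<bar>binomial_moment l n (G n) j - poisson_moment l n (G n) j\<bar>)"
  \<comment> \<open>The dominating function: the base \<open>2 * C\<close> joins the weight
    \<open>2 ^ j m\<close> to the common bound \<open>C ^ j m / fact (j m)\<close>, and the leading
    2 adds the bounds of the two moments.\<close>
  define b where "b = (\<lambda>j. 2 * (\<Prod>m\<in>{1..l}. (2 * real C) ^ j m / fact (j m)))"
  have fam: "bounded_degree_family (G n) {..<2 * n} C {1..l}" if "n \<ge> 1" for n
  proof
    fix m e assume "m \<in> {1..l}" "e \<in> G n m"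
    then show "e \<subseteq> {..<2 * n} \<and> card e = 2"
      using assms(2)[OF that] by (fastforce simp: G_def subgraph_def complete_nat_graph_def)
  next
    fix m v assume m: "m \<in> {1..l}"
    have "card {e \<in> edges (D n m). v \<in> e} \<le> max_degree (D n m)"
      using assms(2)[OF that m] by (intro card_edges_at_le_max_degree) (auto simp: subgraph_def)
    then show "card {e \<in> G n m. v \<in> e} \<le> C"
      using assms(4)[OF that m] by (simp add: G_def)
  qed simp
  have bm: "binomial_moment l n (G n) j = factorial_moment (G n) {..<2 * n} w / (\<Prod>m\<in>{1..l}. fact (j m))"
    if "n \<ge> 1" "set w \<subseteq> {1..l}" "\<And>m. m \<in> {1..l} \<Longrightarrow> count_list w m = j m" for n j w
    using that assms(3)[of n] bounded_degree_family.edge[OF fam]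
    by (intro binomial_moment_eq) (auto simp: G_def)
  have pm: "poisson_moment l n (G n) j
      = (\<Prod>m\<leftarrow>w. card (G n m) / (2 * real n)) / (\<Prod>m\<in>{1..l}. fact (j m))"
    if "set w \<subseteq> {1..l}" "\<And>m. m \<in> {1..l} \<Longrightarrow> count_list w m = j m" for n j w
    using that by (simp add: poisson_moment_def prod_list_map_eq_prod_count[of "{1..l}"] prod_dividef)
  have Cpow: "real C ^ (\<Sum>m\<in>{1..l}. j m) = (\<Prod>m\<in>{1..l}. real C ^ j m)" for j :: "nat \<Rightarrow> nat"
    by (rule power_sum)
  have h_le: "norm (h n j) \<le> b j" if n: "n \<ge> 1" for n j
  proof -
    interpret bounded_degree_family "G n" "{..<2 * n}" C "{1..l}" by (rule fam[OF n])
    let ?c = "\<Prod>m\<in>{1..l}. real C ^ j m / fact (j m)"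
    obtain w where w: "set w \<subseteq> {1..l}" "\<And>m. m \<in> {1..l} \<Longrightarrow> count_list w m = j m"
      using ex_list_with_counts[of "{1..l}" j] by blast
    have len: "length w = (\<Sum>m\<in>{1..l}. j m)"
      using w length_eq_sum_count_list[of "{1..l}" w] by simp
    have "0 \<le> factorial_moment (G n) {..<2 * n} w \<and> factorial_moment (G n) {..<2 * n} w \<le> real C ^ length w"
      using w by (intro factorial_moment_bounds) auto
    moreover have bm_eq: "binomial_moment l n (G n) j
        = factorial_moment (G n) {..<2 * n} w / (\<Prod>m\<in>{1..l}. fact (j m))"
      using n w by (intro bm)
    ultimately have 1: "0 \<le> binomial_moment l n (G n) j \<and> binomial_moment l n (G n) j \<le> ?c"
      unfolding bm_eq prod_dividef len Cpow
      by (auto intro!: divide_right_mono divide_nonneg_nonneg prod_nonneg)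
    have "card (G n m) / (2 * real n) \<le> C" if m: "m \<in> {1..l}" for m
    proof -
      have "card (G n m) \<le> C * n" using card_edges_total[OF m] by simp
      also have "\<dots> \<le> C * (2 * n)" by simp
      finally have "real (card (G n m)) \<le> real (C * (2 * n))" by (simp only: of_nat_le_iff)
      then show ?thesis using n by (simp add: divide_le_eq)
    qed
    then have 2: "0 \<le> poisson_moment l n (G n) j \<and> poisson_moment l n (G n) j \<le> ?c"
      unfolding poisson_moment_def by (auto intro!: prod_nonneg prod_mono divide_right_mono power_mono)
    have "norm (h n j) \<le> 2 ^ (\<Sum>m\<in>{1..l}. j m) * (2 * ?c)"
      using 1 2 by (auto simp: h_def abs_mult)
    also have "\<dots> = b j"
      by (simp add: b_def power_sum power_mult_distrib prod.distrib prod_dividef)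
    finally show ?thesis .
  qed
  have b: "b summable_on nat_vectors l"
  proof -
    \<comment> \<open>Up to the factor 2, \<open>b\<close> is a product of \<open>l\<close>
      exponential series at \<open>2 * C\<close>.\<close>
    have s: "summable (\<lambda>i. norm ((2 * real C) ^ i / fact i))"
      using summable_norm_exp[of "2 * real C"] by (simp add: divide_inverse mult.commute)
    have "(\<lambda>j. norm (\<Prod>m\<in>{1..l}. (2 * real C) ^ j m / fact (j m))) summable_on nat_vectors l"
      unfolding nat_vectors_def
      by (rule abs_summable_prod_PiE)
        (use norm_summable_imp_has_sum[OF s summable_sums[OF summable_norm_cancel[OF s]]]
          norm_summable_imp_summable_on[of "\<lambda>i. norm ((2 * real C) ^ i / fact i)"] s in auto)
    then show ?thesis
      unfolding b_def by (intro summable_on_cmult_right) (rule abs_summable_summable)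
  qed
  have b0: "0 \<le> b j" for j by (auto simp: b_def intro!: prod_nonneg)
  have lim: "(\<lambda>n. h n j) \<longlonglongrightarrow> 0" for j
  proof -
    obtain w where w: "set w \<subseteq> {1..l}" "\<And>m. m \<in> {1..l} \<Longrightarrow> count_list w m = j m"
      using ex_list_with_counts[of "{1..l}" j] by blast
    have "(\<lambda>n. factorial_moment (G n) {..<2 * n} w - (\<Prod>m\<leftarrow>w. card (G n m) / (2 * real n))) \<longlonglongrightarrow> 0"
    proof (rule tendstoI)
      fix e :: real assume "e > 0"
      \<comment> \<open>Only \<open>U = {..<2 * n}\<close>, with \<open>s = 0\<close> deleted
        vertices, is used; halving \<open>e\<close> gives the strict inequality.\<close>
      have "\<forall>\<^sub>F n in sequentially. \<forall>U. U \<subseteq> {..<2 * n} \<longrightarrow> even (card U) \<longrightarrow> card ({..<2 * n} - U) \<le> 0 \<longrightarrow>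
           \<bar>factorial_moment (G n) U w - (\<Prod>m\<leftarrow>w. card (G n m) / (2 * real n))\<bar> \<le> e / 2"
        by (rule factorial_moment_approx[where V = "\<lambda>n. {..<2 * n}"])
          (use fam w(1) \<open>e > 0\<close> in auto)
      then show "\<forall>\<^sub>F n in sequentially.
          dist (factorial_moment (G n) {..<2 * n} w - (\<Prod>m\<leftarrow>w. card (G n m) / (2 * real n))) 0 < e"
      proof eventually_elim
        case (elim n)
        then have "\<bar>factorial_moment (G n) {..<2 * n} w - (\<Prod>m\<leftarrow>w. card (G n m) / (2 * real n))\<bar> \<le> e / 2"
          by simp
        then show ?case using \<open>e > 0\<close> by (simp add: dist_real_def)
      qed
    qed
    from tendsto_mult_right[OF tendsto_rabs[OF tendsto_divide[OF this tendsto_const[of "\<Prod>m\<in>{1..l}. fact (j m)"]]],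
        of "2 ^ (\<Sum>m\<in>{1..l}. j m)"]
    have "(\<lambda>n. 2 ^ (\<Sum>m\<in>{1..l}. j m) * \<bar>(factorial_moment (G n) {..<2 * n} w
        - (\<Prod>m\<leftarrow>w. card (G n m) / (2 * real n))) / (\<Prod>m\<in>{1..l}. fact (j m))\<bar>) \<longlonglongrightarrow> 0"
      by (simp add: mult.commute)
    \<comment> \<open>The word formula \<open>bm\<close> holds from \<open>n = 1\<close> on, so the
      two sequences agree eventually.\<close>
    moreover have "\<forall>\<^sub>F n in sequentially. 2 ^ (\<Sum>m\<in>{1..l}. j m) * \<bar>(factorial_moment (G n) {..<2 * n} w
        - (\<Prod>m\<leftarrow>w. card (G n m) / (2 * real n))) / (\<Prod>m\<in>{1..l}. fact (j m))\<bar> = h n j"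
      using eventually_ge_at_top[of 1]
    proof eventually_elim
      case (elim n)
      have "binomial_moment l n (G n) j = factorial_moment (G n) {..<2 * n} w / (\<Prod>m\<in>{1..l}. fact (j m))"
        using elim w by (intro bm)
      moreover have "poisson_moment l n (G n) j
          = (\<Prod>m\<leftarrow>w. card (G n m) / (2 * real n)) / (\<Prod>m\<in>{1..l}. fact (j m))"
        using w by (intro pm)
      ultimately show ?case by (simp only: h_def diff_divide_distrib)
    qed
    ultimately show ?thesis by (rule Lim_transform_eventually)
  qed
  have "(\<lambda>n. infsum (h n) (nat_vectors l)) \<longlonglongrightarrow> infsum (\<lambda>_. 0) (nat_vectors l)"
    by (rule tendsto_infsum_dominated[OF b b0 h_le lim])
  then have H: "(\<lambda>n. infsum (h n) (nat_vectors l)) \<longlonglongrightarrow> 0" by simp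
  have le: "d_TV l (law_X l n (D n)) (law_Y l n (D n)) \<le> infsum (h n) (nat_vectors l)" if "n \<ge> 1" for n
  proof -
    have "h n summable_on nat_vectors l"
      using h_le[OF that] by (intro summable_on_comparison_test[OF b]) (auto simp: h_def)
    then show ?thesis
      unfolding h_def G_def using has_sum_law_X has_sum_law_Y by (intro d_TV_le_moments)
  qed
  have ge: "0 \<le> d_TV l (law_X l n (D n)) (law_Y l n (D n))" for n
    unfolding d_TV_def by (intro infsum_nonneg) auto
  have "\<forall>\<^sub>F n in sequentially. d_TV l (law_X l n (D n)) (law_Y l n (D n)) \<le> infsum (h n) (nat_vectors l)"
    using eventually_ge_at_top[of 1] by eventually_elim (rule le)
  then show ?thesis
    by (rule tendsto_sandwich[OF always_eventually _ tendsto_const H, rotated]) (simp add: ge)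
qed

end
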